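(* For every finite unit disk graph $G$, $$\gamma(G)\le \frac{18\sqrt3}{\pi}\,\rho(G) <10\,\rho(G).$$
   Context: A unit disk graph is a graph $G$ admitting a representation $p:V(G)\to\mathbb R^2$ such that, for distinct vertices $u,v$, we have $uv\in E(G)$ if and only if the Euclidean distance between $p(u)$ and $p(v)$ is at most $1$. For a graph $G$ and a set $D\subseteq V(G)$, the closed neighbourhood $N_G[D]$ is the set of all vertices that belong to $D$ or are adjacent to a vertex of $D$; write $N_G[v]=N_G[\{v\}]$. The domination number $\gamma(G)$ is the minimum size of a set $D\subseteq V(G)$ with $N_G[D]=V(G)$. The packing number $\rho(G)$ is the maximum size of a set $P\subseteq V(G)$ such that the closed neighbourhoods $N_G[v]$, $v\in P$, are pairwise disjoint (equivalently, the vertices of $P$ are pairwise at graph distance larger than $2$). *)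

theory Defs
  imports "HOL-Analysis.Analysis" "Graph_Theory.Digraph"
begin

text \<open>
  A finite simple graph is a \<open>graph\<close> in the sense of \<open>Graph_Theory\<close>: a finite symmetric digraph
  without loops and without parallel arcs. An edge \<open>uv\<close> is the pair of arcs between \<open>u\<close> and \<open>v\<close>,
  and adjacency is \<open>u \<rightarrow>\<^bsub>G\<^esub> v\<close>. The graph may have no vertices.
\<close>

definition unit_disk_representation :: "('a, 'b) pre_digraph \<Rightarrow> ('a \<Rightarrow> real ^ 2) \<Rightarrow> bool" where
  "unit_disk_representation G p \<longleftrightarrow>
     (\<forall>u \<in> verts G. \<forall>v \<in> verts G. u \<noteq> v \<longrightarrow> (u \<rightarrow>\<^bsub>G\<^esub> v \<longleftrightarrow> dist (p u) (p v) \<le> 1))"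

definition unit_disk_graph :: "('a, 'b) pre_digraph \<Rightarrow> bool" where
  "unit_disk_graph G \<longleftrightarrow> graph G \<and> (\<exists>p. unit_disk_representation G p)"

definition closed_neighbourhood :: "('a, 'b) pre_digraph \<Rightarrow> 'a set \<Rightarrow> 'a set" where
  "closed_neighbourhood G D = {v \<in> verts G. v \<in> D \<or> (\<exists>u \<in> D. u \<rightarrow>\<^bsub>G\<^esub> v)}"

definition dominating_set :: "('a, 'b) pre_digraph \<Rightarrow> 'a set \<Rightarrow> bool" where
  "dominating_set G D \<longleftrightarrow> D \<subseteq> verts G \<and> closed_neighbourhood G D = verts G"

text \<open>
  The family of neighbourhoods is indexed by \<open>P\<close>: two distinct vertices with the same closed
  neighbourhood cannot both belong to a packing.
\<close>

definition packing :: "('a, 'b) pre_digraph \<Rightarrow> 'a set \<Rightarrow> bool" where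
  "packing G P \<longleftrightarrow> P \<subseteq> verts G \<and> disjoint_family_on (\<lambda>v. closed_neighbourhood G {v}) P"

text \<open>
  In a finite graph the vertex set is dominating and the empty set is a packing, so the minimum
  and the maximum below are over finite nonempty sets.
\<close>

definition domination_number :: "('a, 'b) pre_digraph \<Rightarrow> nat" where
  "domination_number G = Min (card ` {D. dominating_set G D})"

definition packing_number :: "('a, 'b) pre_digraph \<Rightarrow> nat" where
  "packing_number G = Max (card ` {P. packing G P})"

end

theory Submission
  imports Defs
begin

text \<open>
  In a unit disk graph, two vertices whose points are more than \<open>2\<close> apart have disjoint closed
  neighbourhoods, and a maximal independent set \<open>D\<close> is dominating. It therefore suffices to find,
  among the points \<open>X\<close> of \<open>D\<close>, which are pairwise more than \<open>1\<close> apart, at least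
  \<open>\<pi> / (18 \<surd>3) * card X\<close> points that are pairwise more than \<open>2\<close> apart.

  The open disks of radius \<open>1/2\<close> around \<open>X\<close> are disjoint; their union \<open>A\<close> has area
  \<open>card X * \<pi> / 4\<close>. Put a triangular lattice of minimum distance \<open>3\<close> on the plane and translate it
  at random. Its cells have area \<open>9 \<surd>3 / 2\<close>, so on average \<open>card X * \<pi> / 4\<close> divided by
  \<open>9 \<surd>3 / 2\<close> points of the translated lattice lie in \<open>A\<close>. Some translate does at least as well as
  the average; this is Blichfeldt's principle (\<open>blichfeldt\<close>). Two of its points are at least \<open>3\<close>
  apart and each is less than \<open>1/2\<close> away from the centre of its disk, so the centres are more than
  \<open>2\<close> apart, and there are at least \<open>card X * \<pi> / (18 \<surd>3)\<close> of them.

  The triangular lattice is the densest one for its minimum distance, which is why the constant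
  is \<open>9\<close> divided by the packing density \<open>\<pi> / \<surd>12\<close> of equal disks in the plane.
\<close>

section \<open>Blichfeldt's principle\<close>

text \<open>
  Measure the pairs of a point \<open>t \<in> F\<close> and a translation \<open>l \<in> L\<close> with \<open>t + l \<in> A\<close> in two ways. The
  translates of \<open>F\<close> cover \<open>A\<close>, so integrating over \<open>t\<close> first gives at least the volume of \<open>A\<close>;
  summing over \<open>l\<close> first gives at most \<open>k\<close> for each \<open>t\<close>.
\<close>

lemma blichfeldt:
  fixes A F L :: "'a::euclidean_space set"
  assumes A [measurable]: "A \<in> sets borel" and F [measurable]: "F \<in> sets borel"
    and L: "countable L"
    and cover: "\<And>y. y \<in> A \<Longrightarrow> \<exists>l\<in>L. y - l \<in> F"
    and fin: "\<And>t. t \<in> F \<Longrightarrow> finite {l\<in>L. t + l \<in> A}"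
    and card: "\<And>t. t \<in> F \<Longrightarrow> card {l\<in>L. t + l \<in> A} \<le> k"
  shows "emeasure lborel A \<le> of_nat k * emeasure lborel F"
proof -
  have "emeasure lborel A = (\<integral>\<^sup>+y. indicator A y \<partial>lborel)"
    by simp
  also have "\<dots> \<le> (\<integral>\<^sup>+y. \<integral>\<^sup>+l. indicator A y * indicator F (y - l) \<partial>count_space L \<partial>lborel)"
  proof (intro nn_integral_mono)
    fix y
    show "indicator A y \<le> (\<integral>\<^sup>+l. indicator A y * indicator F (y - l) \<partial>count_space L)"
    proof (cases "y \<in> A")
      case True
      then obtain l where "l \<in> L" "y - l \<in> F"
        using cover by blast
      then show ?thesis
        using nn_integral_ge_point[of l L "\<lambda>l. indicator A y * indicator F (y - l)"] True
        by (simp add: indicator_def)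
    qed simp
  qed
  also have "\<dots> = (\<integral>\<^sup>+l. \<integral>\<^sup>+y. indicator A y * indicator F (y - l) \<partial>lborel \<partial>count_space L)"
    by (intro nn_integral_count_space_nn_integral L) measurable
  also have "\<dots> = (\<integral>\<^sup>+l. \<integral>\<^sup>+t. indicator A (t + l) * indicator F t \<partial>lborel \<partial>count_space L)"
  proof (rule nn_integral_cong)
    fix l :: 'a
    have "(\<integral>\<^sup>+y. indicator A y * indicator F (y - l) \<partial>lborel)
        = (\<integral>\<^sup>+y. indicator A y * indicator F (y - l) \<partial>distr lborel borel ((+) l))"
      by (simp add: lborel_distr_plus)
    also have "\<dots> = (\<integral>\<^sup>+t. indicator A (l + t) * indicator F (l + t - l) \<partial>lborel)"
      by (rule nn_integral_distr) measurable
    finally show "(\<integral>\<^sup>+y. indicator A y * indicator F (y - l) \<partial>lborel)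
        = (\<integral>\<^sup>+t. indicator A (t + l) * indicator F t \<partial>lborel)"
      by (simp add: add.commute)
  qed
  also have "\<dots> = (\<integral>\<^sup>+t. \<integral>\<^sup>+l. indicator A (t + l) * indicator F t \<partial>count_space L \<partial>lborel)"
    by (intro nn_integral_count_space_nn_integral[symmetric] L) measurable
  also have "\<dots> \<le> (\<integral>\<^sup>+t. of_nat k * indicator F t \<partial>lborel)"
  proof (intro nn_integral_mono)
    fix t
    show "(\<integral>\<^sup>+l. indicator A (t + l) * indicator F t \<partial>count_space L) \<le> of_nat k * indicator F t"
    proof (cases "t \<in> F")
      case True
      have "(\<integral>\<^sup>+l. indicator A (t + l) * indicator F t \<partial>count_space L)
          = (\<integral>\<^sup>+l. indicator {l\<in>L. t + l \<in> A} l \<partial>count_space L)"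
        using True by (intro nn_integral_cong) (auto simp: indicator_def)
      also have "\<dots> = of_nat (card {l\<in>L. t + l \<in> A})"
        using fin[OF True] by (subst nn_integral_indicator) auto
      also have "\<dots> \<le> of_nat k"
        using card[OF True] by simp
      finally show ?thesis
        using True by simp
    qed simp
  qed
  also have "\<dots> = of_nat k * emeasure lborel F"
    by (simp add: nn_integral_cmult_indicator)
  finally show ?thesis .
qed

section \<open>The triangular lattice of minimum distance 3\<close>

text \<open>
  The basis vectors \<open>(3, 0)\<close> and \<open>(3/2, 3 \<surd>3 / 2)\<close> are two sides of an equilateral triangle.
\<close>

definition triangular_lattice :: "(real ^ 2) set" where
  "triangular_lattice =
     range (\<lambda>(m, n). vector [3 * of_int m + 3 / 2 * of_int n, 3 * sqrt 3 / 2 * of_int n])"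

text \<open>
  The squared norm of a lattice vector is \<open>9 (m\<^sup>2 + m n + n\<^sup>2)\<close>, where the second factor is an
  integer, positive unless \<open>m = n = 0\<close>.
\<close>

lemma triangular_lattice_dist_ge:
  assumes "l \<in> triangular_lattice" "l' \<in> triangular_lattice" "l \<noteq> l'"
  shows "3 \<le> dist l l'"
proof -
  obtain m n where l: "l = vector [3 * of_int m + 3 / 2 * of_int n, 3 * sqrt 3 / 2 * of_int n]"
    using assms(1) by (auto simp: triangular_lattice_def)
  obtain m' n' where
    l': "l' = vector [3 * of_int m' + 3 / 2 * of_int n', 3 * sqrt 3 / 2 * of_int n']"
    using assms(2) by (auto simp: triangular_lattice_def)
  define a b where "a = m - m'" and "b = n - n'"
  have "a \<noteq> 0 \<or> b \<noteq> 0"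
    using assms(3) l l' by (auto simp: a_def b_def)
  then have "0 < (2 * a + b)\<^sup>2 + 3 * b\<^sup>2"
    by (cases "b = 0") (auto intro: add_nonneg_pos)
  then have "1 \<le> a\<^sup>2 + a * b + b\<^sup>2"
    by (simp add: power2_eq_square algebra_simps)
  then have "1 \<le> real_of_int (a\<^sup>2 + a * b + b\<^sup>2)"
    by linarith
  moreover have "(dist l l')\<^sup>2
      = (3 * of_int a + 3 / 2 * of_int b)\<^sup>2 + (3 * sqrt 3 / 2 * of_int b)\<^sup>2"
    unfolding dist_vec_def L2_set_def sum_2 l l' a_def b_def
    by (simp add: dist_real_def algebra_simps diff_divide_distrib)
  moreover have "\<dots> = 9 * real_of_int (a\<^sup>2 + a * b + b\<^sup>2)"
    by (simp add: power2_eq_square algebra_simps)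
  ultimately have "3\<^sup>2 \<le> (dist l l')\<^sup>2"
    by simp
  then show ?thesis
    by (rule power2_le_imp_le) simp
qed

text \<open>
  The second coordinate can be reduced by the second basis vector and then, without changing it,
  the first coordinate by \<open>(3, 0)\<close>. So a rectangle is a fundamental domain, although the lattice is
  not rectangular.
\<close>

lemma triangular_lattice_rectangle_cover:
  "\<exists>l\<in>triangular_lattice. y - l \<in> cbox 0 (vector [3, 3 * sqrt 3 / 2])"
proof -
  define h where "h = 3 * sqrt 3 / 2"
  define n where "n = \<lfloor>y $ 2 / h\<rfloor>"
  define m where "m = \<lfloor>(y $ 1 - 3 / 2 * of_int n) / 3\<rfloor>"
  have h: "0 < h" by (simp add: h_def)
  have "of_int n \<le> y $ 2 / h" "y $ 2 / h \<le> of_int n + 1"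
    unfolding n_def by linarith+
  then have 2: "0 \<le> y $ 2 - h * of_int n" "y $ 2 - h * of_int n \<le> h"
    using h by (simp_all add: field_simps)
  have "of_int m \<le> (y $ 1 - 3 / 2 * of_int n) / 3" "(y $ 1 - 3 / 2 * of_int n) / 3 \<le> of_int m + 1"
    unfolding m_def by linarith+
  then have 1: "0 \<le> y $ 1 - (3 * of_int m + 3 / 2 * of_int n)"
    "y $ 1 - (3 * of_int m + 3 / 2 * of_int n) \<le> 3"
    by (simp_all add: field_simps)
  have "vector [3 * of_int m + 3 / 2 * of_int n, h * of_int n] \<in> triangular_lattice"
    unfolding triangular_lattice_def h_def by (rule image_eqI[of _ _ "(m, n)"]) auto
  moreover have "y - vector [3 * of_int m + 3 / 2 * of_int n, h * of_int n] \<in> cbox 0 (vector [3, h])"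
    using 1 2 by (simp add: mem_box_cart forall_2)
  ultimately show ?thesis
    unfolding h_def by blast
qed

section \<open>Thinning out a separated point set\<close>

text \<open>
  The constants are matched: with disks of radius \<open>1/2\<close> and lattice distance \<open>3\<close>, lattice points in
  different disks force the centres more than \<open>3 - 2 * (1/2) = 2\<close> apart, where the strictness comes
  from the disks being open.
\<close>

lemma card_separated_le:
  fixes X :: "(real ^ 2) set"
  assumes fin: "finite X"
    and sep: "\<And>x y. x \<in> X \<Longrightarrow> y \<in> X \<Longrightarrow> x \<noteq> y \<Longrightarrow> 1 \<le> dist x y"
    and bound: "\<And>P. P \<subseteq> X \<Longrightarrow> (\<And>x y. x \<in> P \<Longrightarrow> y \<in> P \<Longrightarrow> x \<noteq> y \<Longrightarrow> 2 < dist x y) \<Longrightarrow> card P \<le> k"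
  shows "real (card X) \<le> 18 * sqrt 3 / pi * real k"
proof -
  define A where "A = (\<Union>x\<in>X. ball x (1 / 2))"
  define F :: "(real ^ 2) set" where "F = cbox 0 (vector [3, 3 * sqrt 3 / 2])"
  have hits: "finite {l\<in>triangular_lattice. t + l \<in> A} \<and> card {l\<in>triangular_lattice. t + l \<in> A} \<le> k"
    (is "finite ?H \<and> _") for t
  proof -
    have "\<forall>l\<in>?H. \<exists>x. x \<in> X \<and> dist x (t + l) < 1 / 2"
      by (auto simp: A_def)
    from bchoice[OF this]
    obtain c where c: "\<And>l. l \<in> ?H \<Longrightarrow> c l \<in> X \<and> dist (c l) (t + l) < 1 / 2"
      by blast
    have far: "2 < dist (c l) (c l')" if "l \<in> ?H" "l' \<in> ?H" "l \<noteq> l'" for l l'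
    proof -
      have "3 \<le> dist (t + l) (t + l')"
        using triangular_lattice_dist_ge that by (simp add: dist_norm)
      also have "\<dots> \<le> dist (t + l) (c l) + dist (c l) (c l') + dist (c l') (t + l')"
        using dist_triangle[of "t + l" "t + l'" "c l"] dist_triangle[of "c l" "t + l'" "c l'"]
        by linarith
      also have "\<dots> < 1 / 2 + dist (c l) (c l') + 1 / 2"
        using c[OF that(1)] c[OF that(2)] by (simp add: dist_commute)
      finally show ?thesis by simp
    qed
    have inj: "inj_on c ?H"
    proof (rule inj_onI, rule ccontr)
      fix l l' assume "l \<in> ?H" "l' \<in> ?H" "c l = c l'" "l \<noteq> l'"
      then show False using far[of l l'] by simp
    qed
    have sub: "c ` ?H \<subseteq> X"
      using c by blast
    have "card (c ` ?H) \<le> k"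
      by (rule bound[OF sub]) (use far in blast)
    moreover have "finite ?H"
      using finite_subset[OF sub fin] inj by (rule finite_imageD)
    ultimately show ?thesis
      using card_image[OF inj] by simp
  qed
  have "disjoint_family_on (\<lambda>x. ball x (1 / 2)) X"
    unfolding disjoint_family_on_def
  proof (intro ballI impI)
    fix x y assume "x \<in> X" "y \<in> X" "x \<noteq> y"
    then have "1 \<le> dist x y" by (rule sep)
    then show "ball x (1 / 2) \<inter> ball y (1 / 2) = {}"
      by (simp add: disjoint_ballI)
  qed
  then have "emeasure lborel A = (\<Sum>x\<in>X. emeasure lborel (ball x (1 / 2)))"
    unfolding A_def using fin by (intro sum_emeasure[symmetric]) auto
  also have "\<dots> = ennreal (card X * (pi / 4))"
    by (simp add: emeasure_ball unit_ball_vol_2 power2_eq_square ennreal_of_nat_eq_real_of_nat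
      flip: ennreal_mult)
  finally have areaA: "emeasure lborel A = ennreal (card X * (pi / 4))" .
  have ne: "F \<noteq> {}"
    by (auto simp: F_def interval_ne_empty_cart forall_2)
  have "emeasure lborel F = ennreal (measure lborel F)"
    unfolding F_def by (rule emeasure_eq_ennreal_measure) (simp add: emeasure_lborel_cbox_eq)
  also have "measure lborel F = 9 * sqrt 3 / 2"
    using content_cbox_cart[OF ne[unfolded F_def]] by (simp add: F_def UNIV_2)
  finally have areaF: "emeasure lborel F = ennreal (9 * sqrt 3 / 2)" .
  have "emeasure lborel A \<le> of_nat k * emeasure lborel F"
  proof (rule blichfeldt[where L = triangular_lattice])
    show "A \<in> sets borel"
      unfolding A_def by (intro borel_open open_UN) simp
    show "F \<in> sets borel"
      by (simp add: F_def)
    show "countable triangular_lattice"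
      by (simp add: triangular_lattice_def)
  qed (use hits triangular_lattice_rectangle_cover in \<open>auto simp: F_def\<close>)
  then have "card X * (pi / 4) \<le> k * (9 * sqrt 3 / 2)"
    by (simp add: areaA areaF ennreal_of_nat_eq_real_of_nat flip: ennreal_mult)
  then show ?thesis
    by (simp add: field_simps)
qed

section \<open>Unit disk graphs\<close>

lemma packing_if_far_apart:
  assumes G: "graph G" and p: "unit_disk_representation G p" and P: "P \<subseteq> verts G"
    and far: "\<And>u v. u \<in> P \<Longrightarrow> v \<in> P \<Longrightarrow> u \<noteq> v \<Longrightarrow> 2 < dist (p u) (p v)"
  shows "packing G P"
proof -
  interpret graph G by fact
  have near: "dist (p u) (p w) \<le> 1" if "u \<in> P" "w \<in> closed_neighbourhood G {u}" for u w
  proof (cases "u = w")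
    case False
    then show ?thesis
      using that P p by (auto simp: closed_neighbourhood_def unit_disk_representation_def)
  qed simp
  have False if "u \<in> P" "v \<in> P" "u \<noteq> v"
    "w \<in> closed_neighbourhood G {u}" "w \<in> closed_neighbourhood G {v}" for u v w
    using far[OF that(1-3)] near[OF that(1,4)] near[OF that(2,5)]
      dist_triangle2[of "p u" "p v" "p w"] by linarith
  then show ?thesis
    using P unfolding packing_def disjoint_family_on_def by blast
qed

lemma card_packing_le:
  assumes "graph G" "packing G P"
  shows "card P \<le> packing_number G"
proof -
  interpret graph G by fact
  have "finite {P. packing G P}"
    by (rule finite_subset[of _ "Pow (verts G)"]) (auto simp: packing_def)
  then show ?thesis
    unfolding packing_number_def using assms(2) by (intro Max_ge) auto
qed

lemma domination_number_le_card:
  assumes "graph G" "dominating_set G D"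
  shows "domination_number G \<le> card D"
proof -
  interpret graph G by fact
  have "finite {D. dominating_set G D}"
    by (rule finite_subset[of _ "Pow (verts G)"]) (auto simp: dominating_set_def)
  then show ?thesis
    unfolding domination_number_def using assms(2) by (intro Min_le) auto
qed

lemma packing_number_pos:
  assumes "graph G" "verts G \<noteq> {}"
  shows "0 < packing_number G"
proof -
  obtain v where "v \<in> verts G"
    using assms(2) by blast
  then have "packing G {v}"
    by (simp add: packing_def disjoint_family_on_def)
  from card_packing_le[OF assms(1) this] show ?thesis by simp
qed

text \<open>A maximal independent set dominates: an undominated vertex could be added to it.\<close>

lemma ex_independent_dominating_set:
  assumes "graph G"
  obtains D where "dominating_set G D" "\<And>u v. u \<in> D \<Longrightarrow> v \<in> D \<Longrightarrow> \<not> u \<rightarrow>\<^bsub>G\<^esub> v"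
proof -
  interpret graph G by fact
  define \<I> where "\<I> = {D. D \<subseteq> verts G \<and> (\<forall>u\<in>D. \<forall>v\<in>D. \<not> u \<rightarrow>\<^bsub>G\<^esub> v)}"
  have "finite \<I>" "{} \<in> \<I>"
    by (auto simp: \<I>_def)
  then obtain D where D: "D \<in> \<I>" and max: "\<And>E. E \<in> \<I> \<Longrightarrow> D \<subseteq> E \<Longrightarrow> D = E"
    using finite_has_maximal[of \<I>] by blast
  have "v \<in> closed_neighbourhood G D" if v: "v \<in> verts G" for v
  proof (rule ccontr)
    assume "v \<notin> closed_neighbourhood G D"
    then have new: "v \<notin> D" and out: "\<forall>u\<in>D. \<not> u \<rightarrow>\<^bsub>G\<^esub> v"
      using v by (auto simp: closed_neighbourhood_def)
    then have "\<forall>u\<in>D. \<not> v \<rightarrow>\<^bsub>G\<^esub> u"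
      using arcs_ends_symmetric[OF sym_arcs] by blast
    then have "insert v D \<in> \<I>"
      using D v out adj_not_same by (auto simp: \<I>_def)
    then have "v \<in> D"
      using max[of "insert v D"] by blast
    then show False using new by blast
  qed
  then have "dominating_set G D"
    using D by (auto simp: dominating_set_def closed_neighbourhood_def \<I>_def)
  with D show thesis
    by (intro that[of D]) (auto simp: \<I>_def)
qed

theorem theorem1p2:
  fixes G :: "('a, 'b) pre_digraph"
  assumes "unit_disk_graph G"
  shows "real (domination_number G) \<le> 18 * sqrt 3 / pi * real (packing_number G)
       \<and> (verts G \<noteq> {} \<longrightarrow>
            18 * sqrt 3 / pi * real (packing_number G) < 10 * real (packing_number G))"
proof (intro conjI impI)
  obtain p where G: "graph G" and p: "unit_disk_representation G p"
    using assms by (auto simp: unit_disk_graph_def)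
  interpret graph G by (rule G)
  obtain D where dom: "dominating_set G D" and ind: "\<And>u v. u \<in> D \<Longrightarrow> v \<in> D \<Longrightarrow> \<not> u \<rightarrow>\<^bsub>G\<^esub> v"
    by (rule ex_independent_dominating_set[OF G]) blast
  have D: "D \<subseteq> verts G"
    using dom by (simp add: dominating_set_def)
  have apart: "1 < dist (p u) (p v)" if "u \<in> D" "v \<in> D" "u \<noteq> v" for u v
    using that ind[of u v] D p by (force simp: unit_disk_representation_def)
  then have inj: "inj_on p D"
    by (force simp: inj_on_def)
  have "real (card (p ` D)) \<le> 18 * sqrt 3 / pi * real (packing_number G)"
  proof (rule card_separated_le)
    show "finite (p ` D)"
      using finite_subset[OF D finite_verts] by simp
    show "1 \<le> dist x y" if "x \<in> p ` D" "y \<in> p ` D" "x \<noteq> y" for x y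
      using that apart by (auto intro!: less_imp_le)
  next
    fix Q assume Q: "Q \<subseteq> p ` D" and far: "\<And>x y. x \<in> Q \<Longrightarrow> y \<in> Q \<Longrightarrow> x \<noteq> y \<Longrightarrow> 2 < dist x y"
    from Q obtain P where P: "P \<subseteq> D" "Q = p ` P"
      by (auto simp: subset_image_iff)
    have injP: "inj_on p P"
      using inj P(1) by (rule inj_on_subset)
    then have "packing G P"
      using P D far by (intro packing_if_far_apart[OF G p]) (auto simp: inj_on_eq_iff)
    then show "card Q \<le> packing_number G"
      using card_packing_le[OF G] P(2) injP by (simp add: card_image)
  qed
  then show "real (domination_number G) \<le> 18 * sqrt 3 / pi * real (packing_number G)"
    using domination_number_le_card[OF G dom] inj by (simp add: card_image)
  assume "verts G \<noteq> {}"
  then have pos: "0 < real (packing_number G)"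
    using packing_number_pos[OF G] by simp
  have "sqrt 3 < 1.733"
    by (rule real_less_lsqrt) (simp_all add: power2_eq_square)
  then have "18 * sqrt 3 / pi < 10"
    using pi_approx(1) by (simp add: field_simps)
  with pos show "18 * sqrt 3 / pi * real (packing_number G) < 10 * real (packing_number G)"
    by (intro mult_strict_right_mono)
qed

end
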